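(* Let $\mathbf{r}(t)$ be a rational helix whose unit tangent $\mathbf{t}(t)$ is a rational vector field of degree $2$ tracing a small circle on the unit sphere, with $\mathbf{t}'(t)\neq 0$ for all $t$. Then $\mathbf{r}(t)$ cannot have a rational rotation minimizing frame (RRMF).
   Context: All functions are functions of a real parameter $t$ (ranging over an interval on which they are defined and $\mathbf{r}'\neq 0$), and $'$ denotes $d/dt$. Rational functions, vector fields and curves have (component) functions that are quotients of real polynomials in $t$. A rational vector field has degree $2$ if, when its components are written with a common denominator in lowest terms (numerators and denominator having no common factor), the maximal degree of the numerators and denominator is $2$. A rational helix is a rational curve $\mathbf{r}(t)$ in $\mathbb{R}^3$ whose unit tangent $\mathbf{t}(t)=\mathbf{r}'(t)/|\mathbf{r}'(t)|$ makes a constant angle with a constant unit vector; its unit tangent traces a small circle on the unit sphere, where a small circle is a circle on the sphere (not a single point) that is not a great circle (great circles correspond to planar curves). An adapted frame along $\mathbf{r}(t)$ is an orthonormal basis $(\mathbf{f}_1(t),\mathbf{f}_2(t),\mathbf{f}_3(t))$ of $\mathbb{R}^3$, depending smoothly on $t$, with $\mathbf{f}_1(t)=\mathbf{t}(t)$. It is a rotation minimizing frame (RMF) if $\mathbf{f}_2'(t)\cdot\mathbf{f}_3(t)\equiv 0$, and a rational rotation minimizing frame (RRMF) if moreover $\mathbf{f}_1,\mathbf{f}_2,\mathbf{f}_3$ are rational vector fields. *)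

theory Defs
  imports "HOL-Analysis.Analysis" "HOL-Computational_Algebra.Polynomial"
begin

text \<open>
  Curves and vector fields are total functions \<open>real \<Rightarrow> real ^ 3\<close> of which only the values on a
  parameter interval \<open>I\<close> matter. Derivatives are taken within \<open>I\<close>, so that \<open>I\<close> need not be open.
\<close>

definition parameter_interval :: "real set \<Rightarrow> bool" where
  "parameter_interval I \<longleftrightarrow> is_interval I \<and> interior I \<noteq> {}"

definition deriv_on :: "real set \<Rightarrow> (real \<Rightarrow> real ^ 3) \<Rightarrow> real \<Rightarrow> real ^ 3" where
  "deriv_on I f t = vector_derivative f (at t within I)"

text \<open>The denominator has no zero in \<open>I\<close>: the functions have to be defined on all of \<open>I\<close>.\<close>

definition rational_on :: "real set \<Rightarrow> (real \<Rightarrow> real) \<Rightarrow> bool" where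
  "rational_on I f \<longleftrightarrow>
     (\<exists>p q :: real poly. \<forall>t\<in>I. poly q t \<noteq> 0 \<and> f t = poly p t / poly q t)"

definition rational_field_on :: "real set \<Rightarrow> (real \<Rightarrow> real ^ 3) \<Rightarrow> bool" where
  "rational_field_on I f \<longleftrightarrow> (\<forall>i. rational_on I (\<lambda>t. f t $ i))"

text \<open>
  Lowest terms means that the three numerators and the common denominator have no nonconstant
  factor common to all four; single numerators may share factors with the denominator.
\<close>

definition rational_field_of_degree :: "real set \<Rightarrow> (real \<Rightarrow> real ^ 3) \<Rightarrow> nat \<Rightarrow> bool" where
  "rational_field_of_degree I f n \<longleftrightarrow>
     (\<exists>(p :: 3 \<Rightarrow> real poly) (q :: real poly).
        (\<forall>t\<in>I. poly q t \<noteq> 0 \<and> (\<forall>i. f t $ i = poly (p i) t / poly q t)) \<and>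
        (\<forall>d. (\<forall>i. d dvd p i) \<and> d dvd q \<longrightarrow> is_unit d) \<and>
        Max (insert (degree q) (range (\<lambda>i. degree (p i)))) = n)"

definition unit_tangent :: "real set \<Rightarrow> (real \<Rightarrow> real ^ 3) \<Rightarrow> real \<Rightarrow> real ^ 3" where
  "unit_tangent I r t = deriv_on I r t /\<^sub>R norm (deriv_on I r t)"

definition rational_helix :: "real set \<Rightarrow> (real \<Rightarrow> real ^ 3) \<Rightarrow> bool" where
  "rational_helix I r \<longleftrightarrow>
     rational_field_on I r \<and>
     (\<forall>t\<in>I. deriv_on I r t \<noteq> 0) \<and>
     (\<exists>a \<psi>. norm a = 1 \<and> (\<forall>t\<in>I. unit_tangent I r t \<bullet> a = cos \<psi>))"

text \<open>
  A circle on the unit sphere is a section by a plane at distance less than \<open>1\<close> from the origin;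
  it is a great circle if the plane can be taken through the origin.
\<close>

definition circle_on_sphere :: "(real ^ 3) set \<Rightarrow> bool" where
  "circle_on_sphere C \<longleftrightarrow> (\<exists>a c. norm a = 1 \<and> \<bar>c\<bar> < 1 \<and> C = {x \<in> sphere 0 1. x \<bullet> a = c})"

definition great_circle :: "(real ^ 3) set \<Rightarrow> bool" where
  "great_circle C \<longleftrightarrow> (\<exists>a. norm a = 1 \<and> C = {x \<in> sphere 0 1. x \<bullet> a = 0})"

definition small_circle :: "(real ^ 3) set \<Rightarrow> bool" where
  "small_circle C \<longleftrightarrow> circle_on_sphere C \<and> \<not> great_circle C"

text \<open>
  Only containment is required, since over a proper interval the unit tangent covers just an arc,
  and even over the whole real line a rational parametrization of degree \<open>2\<close> omits a point.
\<close>

definition traces_small_circle :: "real set \<Rightarrow> (real \<Rightarrow> real ^ 3) \<Rightarrow> bool" where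
  "traces_small_circle I f \<longleftrightarrow> (\<exists>C. small_circle C \<and> f ` I \<subseteq> C)"

text \<open>\<open>D n\<close> is the \<open>n\<close>-th derivative of \<open>f\<close> on \<open>I\<close>.\<close>

definition smooth_on :: "real set \<Rightarrow> (real \<Rightarrow> real ^ 3) \<Rightarrow> bool" where
  "smooth_on I f \<longleftrightarrow>
     (\<exists>D :: nat \<Rightarrow> real \<Rightarrow> real ^ 3.
        (\<forall>t\<in>I. D 0 t = f t) \<and>
        (\<forall>n. \<forall>t\<in>I. (D n has_vector_derivative D (Suc n) t) (at t within I)))"

definition orthonormal_basis :: "real ^ 3 \<Rightarrow> real ^ 3 \<Rightarrow> real ^ 3 \<Rightarrow> bool" where
  "orthonormal_basis u v w \<longleftrightarrow>
     norm u = 1 \<and> norm v = 1 \<and> norm w = 1 \<and>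
     orthogonal u v \<and> orthogonal u w \<and> orthogonal v w \<and>
     span {u, v, w} = UNIV"

definition adapted_frame ::
  "real set \<Rightarrow> (real \<Rightarrow> real ^ 3) \<Rightarrow>
   (real \<Rightarrow> real ^ 3) \<Rightarrow> (real \<Rightarrow> real ^ 3) \<Rightarrow> (real \<Rightarrow> real ^ 3) \<Rightarrow> bool" where
  "adapted_frame I r f1 f2 f3 \<longleftrightarrow>
     (\<forall>t\<in>I. orthonormal_basis (f1 t) (f2 t) (f3 t)) \<and>
     smooth_on I f1 \<and> smooth_on I f2 \<and> smooth_on I f3 \<and>
     (\<forall>t\<in>I. f1 t = unit_tangent I r t)"

definition rotation_minimizing_frame ::
  "real set \<Rightarrow> (real \<Rightarrow> real ^ 3) \<Rightarrow>
   (real \<Rightarrow> real ^ 3) \<Rightarrow> (real \<Rightarrow> real ^ 3) \<Rightarrow> (real \<Rightarrow> real ^ 3) \<Rightarrow> bool" where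
  "rotation_minimizing_frame I r f1 f2 f3 \<longleftrightarrow>
     adapted_frame I r f1 f2 f3 \<and> (\<forall>t\<in>I. deriv_on I f2 t \<bullet> f3 t = 0)"

definition rational_rotation_minimizing_frame ::
  "real set \<Rightarrow> (real \<Rightarrow> real ^ 3) \<Rightarrow>
   (real \<Rightarrow> real ^ 3) \<Rightarrow> (real \<Rightarrow> real ^ 3) \<Rightarrow> (real \<Rightarrow> real ^ 3) \<Rightarrow> bool" where
  "rational_rotation_minimizing_frame I r f1 f2 f3 \<longleftrightarrow>
     rotation_minimizing_frame I r f1 f2 f3 \<and>
     rational_field_on I f1 \<and> rational_field_on I f2 \<and> rational_field_on I f3"

end

theory Submission
  imports Defs
begin

text \<open>
  Let \<open>a\<close> be the axis of the small circle and \<open>c = T \<bullet> a\<close> the constant component of the unit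
  tangent \<open>T\<close> along it, so that \<open>0 < \<bar>c\<bar> < 1\<close>. While \<open>T\<close> turns around the axis by an angle \<open>\<theta>\<close>, a
  rotation minimizing frame \<open>(T, f, g)\<close> turns by the angle \<open>c \<theta>\<close>, up to sign, relative to the
  frame formed by \<open>T\<close>, \<open>T'\<close> and \<open>T \<times> T'\<close>. If \<open>T\<close> has degree 2, then \<open>exp (\<i> \<theta>)\<close> is, up to a
  constant factor, a quotient \<open>(t - z) / (t - z*)\<close> with conjugate nonreal \<open>z\<close>, \<open>z*\<close>. A rational
  \<open>f\<close> and \<open>g\<close> would make its power with exponent \<open>c\<close> rational, although \<open>c\<close> is not an integer.

  The proof expresses this without angles. The complex function \<open>G = f \<bullet> a + \<i> (g \<bullet> a)\<close>
  records the position of the axis in the normal plane, and the equations of the frame give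
  \<open>(1 - c\<^sup>2) G'\<^sup>2 = - c\<^sup>2 \<bar>T'\<bar>\<^sup>2 G\<^sup>2\<close> (lemma \<open>frame_axis_ode\<close>). If \<open>q = k t\<^sup>2 + l t + m\<close> is
  the common denominator of \<open>T\<close>, then \<open>q\<^sup>2 \<bar>T'\<bar>\<^sup>2 = (1 - c\<^sup>2) D\<close> with the constant
  \<open>D = 4 k m - l\<^sup>2\<close> (lemmas \<open>quadratic_circle_coefficients\<close> and \<open>quadratic_field_speed\<close>). Hence
  \<open>q\<^sup>2 G'\<^sup>2 = - c\<^sup>2 D G\<^sup>2\<close>. If \<open>G\<close> is rational, its logarithmic derivative has integral residues,
  and at a root of \<open>q\<close>, where \<open>q'\<^sup>2 = - D\<close>, the equation says that the square of the residue
  is \<open>c\<^sup>2\<close> (lemma \<open>log_derivative_exponent_integral\<close>). No integer has a square strictly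
  between 0 and 1.
\<close>

section \<open>Squared logarithmic derivatives of rational functions\<close>

lemma poly_eq_0_on_infinite:
  fixes p :: "'a::{comm_ring_1,ring_no_zero_divisors} poly"
  assumes "infinite S" "\<And>t. t \<in> S \<Longrightarrow> poly p t = 0"
  shows "p = 0"
  using assms by (metis (mono_tags, lifting) finite_subset mem_Collect_eq poly_roots_finite subsetI)

text \<open>
  The logarithmic derivative of \<open>A / B\<close> has at \<open>z\<close> the residue \<open>order z A - order z B\<close>, an
  integer. If its square is \<open>g / q\<^sup>2\<close> with \<open>q\<close> vanishing at \<open>z\<close>, comparing the coefficients of
  \<open>(x - z)\<^sup>-\<^sup>2\<close> forces \<open>g\<close> to be the square of this integer times \<open>q' z\<^sup>2\<close>. The squared equation
  is the useful form, because it does not depend on the orientation of a frame.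
\<close>

lemma residue_square_integral:
  fixes A B q :: "complex poly"
  assumes A: "A \<noteq> 0" and B: "B \<noteq> 0" and z: "poly q z = 0"
    and ode: "(q * (pderiv A * B - A * pderiv B)) ^ 2 = smult g ((A * B) ^ 2)"
  shows "\<exists>n::int. g = of_int n ^ 2 * poly (pderiv q) z ^ 2"
proof -
  define l where "l = [:- z, 1:]"
  have l: "poly l z = 0" "pderiv l = 1" "l \<noteq> 0"
    by (simp_all add: l_def pderiv_pCons)
  have ldvd: "l dvd p \<longleftrightarrow> poly p z = 0" for p
    by (simp add: l_def poly_eq_0_iff_dvd)
  have split: "\<exists>C1. C = l ^ n * C1 \<and> poly C1 z \<noteq> 0 \<and>
      l * pderiv C = l ^ n * (smult (of_nat n) C1 + l * pderiv C1)"
    if C: "C \<noteq> 0" and n: "n = order z C" for C n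
  proof -
    obtain C1 where C1: "C = l ^ n * C1" "\<not> l dvd C1"
      using order_decomp[OF C] unfolding l_def n by blast
    have "l * pderiv (l ^ n) = smult (of_nat n) (l ^ n)"
    proof (cases n)
      case (Suc k)
      have "pderiv (l ^ n) = smult (of_nat n) (l ^ k)"
        unfolding Suc pderiv_power_Suc l by simp
      then show ?thesis by (simp only: mult_smult_right Suc power_Suc)
    qed simp
    then have "l * pderiv C = smult (of_nat n) (l ^ n) * C1 + l ^ n * (l * pderiv C1)"
      unfolding C1(1) pderiv_mult by (simp add: distrib_left mult.assoc[symmetric] mult.commute[of C1])
    then show ?thesis using C1 ldvd by (auto simp: algebra_simps)
  qed
  define m n where "m = order z A" and "n = order z B"
  obtain A1 where A1: "A = l ^ m * A1" "poly A1 z \<noteq> 0"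
      "l * pderiv A = l ^ m * (smult (of_nat m) A1 + l * pderiv A1)"
    using split[OF A m_def] by blast
  obtain B1 where B1: "B = l ^ n * B1" "poly B1 z \<noteq> 0"
      "l * pderiv B = l ^ n * (smult (of_nat n) B1 + l * pderiv B1)"
    using split[OF B n_def] by blast
  obtain q1 where q: "q = l * q1"
    using z ldvd by (metis dvd_def)
  have q': "poly (pderiv q) z = poly q1 z"
    by (simp add: q pderiv_mult l)
  \<comment> \<open>\<open>R\<close> is the part of \<open>A' B - A B'\<close> left after the powers of \<open>l\<close> are taken out; only its
    first two terms survive at \<open>z\<close>.\<close>
  define R where "R = smult (of_nat m) (A1 * B1) - smult (of_nat n) (A1 * B1) + l * (pderiv A1 * B1 - A1 * pderiv B1)"
  have "q * (pderiv A * B - A * pderiv B) = q1 * ((l * pderiv A) * B - A * (l * pderiv B))"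
    by (simp only: q) (simp only: algebra_simps)
  also have "\<dots> = q1 * (l ^ m * (smult (of_nat m) A1 + l * pderiv A1) * (l ^ n * B1)
      - l ^ m * A1 * (l ^ n * (smult (of_nat n) B1 + l * pderiv B1)))"
    unfolding A1(3) B1(3) by (simp only: A1(1)[symmetric] B1(1)[symmetric])
  also have "\<dots> = l ^ (m + n) * (q1 * R)"
    by (simp add: R_def power_add algebra_simps)
  finally have eq: "q * (pderiv A * B - A * pderiv B) = l ^ (m + n) * (q1 * R)" .
  have AB: "A * B = l ^ (m + n) * (A1 * B1)"
    by (subst A1(1), subst B1(1)) (simp add: power_add mult_ac)
  have "(l ^ (m + n)) ^ 2 * (q1 * R) ^ 2 = (l ^ (m + n)) ^ 2 * smult g ((A1 * B1) ^ 2)"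
    using ode unfolding eq AB by (simp only: power_mult_distrib mult_smult_right)
  then have "(q1 * R) ^ 2 = smult g ((A1 * B1) ^ 2)" using l(3)
    by (metis mult_left_cancel power_not_zero)
  then have "poly ((q1 * R) ^ 2) z = poly (smult g ((A1 * B1) ^ 2)) z" by simp
  then have "(poly q1 z * ((of_nat m - of_nat n) * (poly A1 z * poly B1 z))) ^ 2
      = g * (poly A1 z * poly B1 z) ^ 2"
    by (simp add: R_def l left_diff_distrib)
  moreover have "poly A1 z * poly B1 z \<noteq> 0"
    using A1(2) B1(2) by simp
  ultimately have "g = of_int (int m - int n) ^ 2 * poly (pderiv q) z ^ 2"
    using q' by (simp add: power_mult_distrib mult_ac)
  then show ?thesis by blast
qed

text \<open>
  With \<open>q = k t\<^sup>2 + l t + m\<close> of discriminant \<open>- D\<close>, the solutions of \<open>q\<^sup>2 G'\<^sup>2 = - c\<^sup>2 D G\<^sup>2\<close> are, up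
  to constants, the powers of \<open>(t - z) / (t - z*)\<close> with exponent \<open>c\<close> or \<open>- c\<close>, where \<open>z\<close> and
  \<open>z*\<close> are the roots of \<open>q\<close>. So a rational solution forces \<open>c\<close> to be an integer, which is the
  previous lemma at one of the roots, where \<open>q' z\<^sup>2 = - D\<close>.
\<close>

lemma log_derivative_exponent_integral:
  fixes A B :: "complex poly" and c k l m :: real
  assumes S: "infinite S" and k: "k \<noteq> 0" and disc: "4 * k * m - l^2 \<noteq> 0" and A: "A \<noteq> 0"
    and B: "\<And>t. t \<in> S \<Longrightarrow> poly B (of_real t) \<noteq> 0"
    and ode: "\<And>t. t \<in> S \<Longrightarrow> of_real ((k * t^2 + l * t + m)^2) *
        ((poly (pderiv A) (of_real t) * poly B (of_real t) - poly A (of_real t) * poly (pderiv B) (of_real t))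
          / poly B (of_real t) ^ 2) ^ 2
      = - of_real (c^2 * (4 * k * m - l^2)) * (poly A (of_real t) / poly B (of_real t)) ^ 2"
  shows "\<exists>n::int. c^2 = (of_int n)^2"
proof -
  define D where "D = 4 * k * m - l^2"
  define q where "q = [:complex_of_real m, of_real l, of_real k:]"
  define g where "g = - complex_of_real (c^2 * D)"
  \<comment> \<open>A root of \<open>q\<close>; \<open>csqrt\<close> covers both signs of \<open>D\<close>.\<close>
  define z where "z = (csqrt (- of_real D) - of_real l) / (2 * of_real k)"
  have z: "2 * of_real k * z + of_real l = csqrt (- of_real D)"
    using k by (simp add: z_def)
  have q': "poly (pderiv q) z ^ 2 = - of_real D"
    using z by (simp add: q_def pderiv_pCons algebra_simps)
  have "4 * of_real k * poly q z = (2 * of_real k * z + of_real l)^2 + of_real D"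
    by (simp add: q_def D_def power2_eq_square algebra_simps)
  then have qz: "poly q z = 0" using k by (simp add: z)
  have "B \<noteq> 0" using S B by (metis finite.emptyI equals0I poly_0)
  have "(q * (pderiv A * B - A * pderiv B)) ^ 2 - smult g ((A * B) ^ 2) = 0"
  proof (rule poly_eq_0_on_infinite)
    show "infinite (complex_of_real ` S)"
      using S by (simp add: finite_image_iff inj_on_def)
    fix x assume "x \<in> complex_of_real ` S"
    then obtain t where t: "t \<in> S" and x: "x = of_real t" by blast
    define b where "b = poly B x"
    define w where "w = poly (pderiv A) x * b - poly A x * poly (pderiv B) x"
    have b: "b \<noteq> 0" using B[OF t] by (simp add: b_def x)
    have qx: "of_real ((k * t^2 + l * t + m)^2) = poly q x ^ 2"
      by (simp add: q_def x power2_eq_square algebra_simps)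
    have "poly q x ^ 2 * (w / b^2) ^ 2 = g * (poly A x / b) ^ 2"
      using ode[OF t] unfolding qx g_def D_def w_def b_def x .
    then have "poly q x ^ 2 * w ^ 2 = g * (poly A x * b) ^ 2"
      using b by (simp add: field_simps power2_eq_square)
    then show "poly ((q * (pderiv A * B - A * pderiv B)) ^ 2 - smult g ((A * B) ^ 2)) x = 0"
      by (simp add: w_def b_def power_mult_distrib)
  qed
  then have "(q * (pderiv A * B - A * pderiv B)) ^ 2 = smult g ((A * B) ^ 2)" by simp
  from residue_square_integral[OF A \<open>B \<noteq> 0\<close> qz this]
  obtain n :: int where "g = of_int n ^ 2 * - of_real D" unfolding q' by blast
  then have "complex_of_real (c^2 * D) = of_real (of_int n ^ 2 * D)"
    by (simp add: g_def)
  then have "c^2 * D = of_int n ^ 2 * D" unfolding of_real_eq_iff .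
  then show ?thesis using disc by (auto simp: D_def)
qed

section \<open>Circles on the sphere parametrized with degree 2\<close>

text \<open>
  In dimension 3, vectors orthogonal to two perpendicular nonzero vectors lie on one line, which
  makes the Cauchy-Schwarz inequality an equality. Both normals are multiples of the cross
  product of \<open>u\<close> and \<open>v\<close>, so that the cross product vanishes.
\<close>

lemma inner_power2_if_common_normals:
  fixes a b u v :: "real ^ 3"
  assumes "a \<noteq> 0" "b \<noteq> 0" "a \<bullet> b = 0" "u \<bullet> a = 0" "u \<bullet> b = 0" "v \<bullet> a = 0" "v \<bullet> b = 0"
  shows "(u \<bullet> v) ^ 2 = (u \<bullet> u) * (v \<bullet> v)"
proof -
  let ?w = "cross3 u v"
  have "cross3 a ?w = 0" "cross3 b ?w = 0"
    using assms by (simp_all add: Lagrange inner_commute[of a u] inner_commute[of a v] inner_commute[of b u] inner_commute[of b v])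
  then have wa: "(?w \<bullet> ?w) *\<^sub>R a = (?w \<bullet> a) *\<^sub>R ?w" and wb: "(?w \<bullet> ?w) *\<^sub>R b = (?w \<bullet> b) *\<^sub>R ?w"
    using Lagrange[of ?w a ?w] Lagrange[of ?w b ?w] by auto
  have "(?w \<bullet> a) * (?w \<bullet> b) = ((?w \<bullet> a) *\<^sub>R ?w) \<bullet> b" by simp
  also have "\<dots> = 0" unfolding wa[symmetric] using assms by simp
  finally have "?w = 0" using wa wb assms by auto
  then show ?thesis using norm_cross_dot[of u v]
    by (simp add: power_mult_distrib dot_square_norm)
qed

text \<open>
  By \<open>quadratic_field_speed\<close> below, the squared speed of a parametrization of a circle by quotients of
  quadratics with denominator \<open>q\<close> is \<open>(B \<bullet> B - l\<^sup>2) / q\<^sup>2\<close>. The last conclusion distinguishes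
  a constant curve from a proper parametrization; in the second case the speed is determined by the
  discriminant of \<open>q\<close> and the radius \<open>sqrt (1 - c\<^sup>2)\<close> of the circle.

  Translating the parameter removes the linear term of the denominator. The linear coefficient \<open>B'\<close>
  of the numerator is then perpendicular to the axis \<open>a\<close> and to the components
  \<open>u\<close>, \<open>v\<close> of the outer coefficients in the plane of the circle. If \<open>B' \<noteq> 0\<close>,
  then \<open>u\<close> and \<open>v\<close> are parallel in that plane, and their lengths are known,
  which leaves two values for \<open>u \<bullet> v\<close> and thus for \<open>B' \<bullet> B'\<close>.
\<close>

lemma quadratic_circle_coefficients:
  fixes A B C a :: "real ^ 3"
  assumes a: "norm a = 1" and S: "infinite S"
    and sphere: "\<And>t. t \<in> S \<Longrightarrow> (t^2 *\<^sub>R A + t *\<^sub>R B + C) \<bullet> (t^2 *\<^sub>R A + t *\<^sub>R B + C) = (k * t^2 + l * t + m) ^ 2"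
    and plane: "\<And>t. t \<in> S \<Longrightarrow> (t^2 *\<^sub>R A + t *\<^sub>R B + C) \<bullet> a = c * (k * t^2 + l * t + m)"
    and nondeg: "A \<noteq> 0 \<or> k \<noteq> 0"
  shows "k \<noteq> 0" "A \<bullet> A = k^2" "A \<bullet> B = k * l"
    and "B \<bullet> B = l^2 \<or> B \<bullet> B - l^2 = (1 - c^2) * (4 * k * m - l^2)"
proof -
  have "[:C \<bullet> C - m^2, 2 * (B \<bullet> C) - 2 * l * m, B \<bullet> B + 2 * (A \<bullet> C) - l^2 - 2 * k * m,
      2 * (A \<bullet> B) - 2 * k * l, A \<bullet> A - k^2:] = 0"
  proof (rule poly_eq_0_on_infinite[OF S])
    fix t assume "t \<in> S"
    from sphere[OF this]
    show "poly [:C \<bullet> C - m^2, 2 * (B \<bullet> C) - 2 * l * m, B \<bullet> B + 2 * (A \<bullet> C) - l^2 - 2 * k * m,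
      2 * (A \<bullet> B) - 2 * k * l, A \<bullet> A - k^2:] t = 0"
      by (simp add: inner_add_left inner_add_right inner_commute[of C A] inner_commute[of C B] inner_commute[of B A]
          power2_eq_square algebra_simps)
  qed
  then have CC: "C \<bullet> C = m^2" and BC: "B \<bullet> C = l * m" and BB: "B \<bullet> B + 2 * (A \<bullet> C) = l^2 + 2 * k * m"
    and AB: "A \<bullet> B = k * l" and AA: "A \<bullet> A = k^2" by auto
  have "[:C \<bullet> a - c * m, B \<bullet> a - c * l, A \<bullet> a - c * k:] = 0"
  proof (rule poly_eq_0_on_infinite[OF S])
    fix t assume "t \<in> S"
    from plane[OF this] show "poly [:C \<bullet> a - c * m, B \<bullet> a - c * l, A \<bullet> a - c * k:] t = 0"
      by (simp add: inner_add_left power2_eq_square algebra_simps)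
  qed
  then have Ca: "C \<bullet> a = c * m" and Ba: "B \<bullet> a = c * l" and Aa: "A \<bullet> a = c * k" by auto
  show k: "k \<noteq> 0" using nondeg AA by auto
  show "A \<bullet> A = k^2" "A \<bullet> B = k * l" by fact+
  \<comment> \<open>The shift \<open>t = s - h\<close> turns the denominator into \<open>k s\<^sup>2 + M\<close> and the numerator into
    \<open>s\<^sup>2 A + s B' + C'\<close>.\<close>
  define h where "h = l / (2 * k)"
  have l: "l = 2 * h * k" using k by (simp add: h_def)
  define B' C' M where "B' = B - (2 * h) *\<^sub>R A" and "C' = C - h *\<^sub>R B + h^2 *\<^sub>R A" and "M = m - h^2 * k"
  define u v where "u = A - (c * k) *\<^sub>R a" and "v = C' - (c * M) *\<^sub>R a"
  have aa: "a \<bullet> a = 1" using a by (simp add: dot_square_norm)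
  note bil = inner_diff_left inner_diff_right inner_add_left inner_add_right
    inner_commute[of B A] inner_commute[of C A] inner_commute[of C B]
    inner_commute[of a A] inner_commute[of a B] inner_commute[of a C]
  have BB': "B' \<bullet> B' = B \<bullet> B - l^2"
    by (simp add: B'_def bil AA AB l power2_eq_square algebra_simps)
  have B'a: "B' \<bullet> a = 0" by (simp add: B'_def bil Aa Ba l)
  have uB': "u \<bullet> B' = 0"
    by (simp add: u_def B'_def bil AA AB Aa Ba l power2_eq_square algebra_simps)
  have vB': "v \<bullet> B' = 0"
  proof -
    have "v \<bullet> B' = (B \<bullet> C - h * (B \<bullet> B) + h^2 * (A \<bullet> B)) - 2 * h * (A \<bullet> C - h * (A \<bullet> B) + h^2 * (A \<bullet> A))
        - c * M * (B \<bullet> a - 2 * h * (A \<bullet> a))"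
      by (simp add: v_def B'_def C'_def bil algebra_simps)
    also have "\<dots> = 0" using BB unfolding BC AB AA Aa Ba l by algebra
    finally show ?thesis .
  qed
  have ua: "u \<bullet> a = 0" by (simp add: u_def bil Aa aa)
  have va: "v \<bullet> a = 0"
    by (simp add: v_def C'_def M_def bil Aa Ba Ca aa l power2_eq_square algebra_simps)
  have AC': "A \<bullet> C' = A \<bullet> C - h^2 * k^2"
    by (simp add: C'_def bil AA AB l power2_eq_square algebra_simps)
  have C'C': "C' \<bullet> C' = M^2"
  proof -
    have "C' \<bullet> C' = C \<bullet> C - 2 * h * (B \<bullet> C) + 2 * h^2 * (A \<bullet> C) + h^2 * (B \<bullet> B) - 2 * h^3 * (A \<bullet> B) + h^4 * (A \<bullet> A)"
      by (simp add: C'_def bil algebra_simps power2_eq_square power3_eq_cube power4_eq_xxxx)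
    also have "\<dots> = M^2" using BB unfolding BC AB AA CC l M_def by algebra
    finally show ?thesis .
  qed
  have C'a: "C' \<bullet> a = c * M"
    by (simp add: C'_def M_def bil Aa Ba Ca l power2_eq_square algebra_simps)
  have uu: "u \<bullet> u = (1 - c^2) * k^2"
    by (simp add: u_def bil AA Aa aa power2_eq_square algebra_simps)
  have vv: "v \<bullet> v = (1 - c^2) * M^2"
    by (simp add: v_def bil C'C' C'a inner_commute[of a C'] aa power2_eq_square algebra_simps)
  have uv: "u \<bullet> v = A \<bullet> C' - c^2 * k * M"
    by (simp add: u_def v_def bil C'a inner_commute[of a C'] Aa aa power2_eq_square algebra_simps)
  have BB2: "B' \<bullet> B' = 2 * k * M - 2 * (A \<bullet> C')"
    using BB by (simp add: BB' AC' M_def l power2_eq_square algebra_simps)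
  show "B \<bullet> B = l^2 \<or> B \<bullet> B - l^2 = (1 - c^2) * (4 * k * m - l^2)"
  proof (cases "B' = 0")
    case True
    then show ?thesis using BB' by simp
  next
    case False
    have "a \<noteq> 0" using a by auto
    have "(u \<bullet> v)^2 = (u \<bullet> u) * (v \<bullet> v)"
      using inner_power2_if_common_normals[OF \<open>a \<noteq> 0\<close> False, of u v] ua va uB' vB' B'a by (simp add: inner_commute[of a B'])
    also have "\<dots> = ((1 - c^2) * k * M)^2" unfolding uu vv by (simp add: power2_eq_square)
    finally have "u \<bullet> v = (1 - c^2) * k * M \<or> u \<bullet> v = - ((1 - c^2) * k * M)"
      by (simp add: power2_eq_iff)
    moreover have kM: "4 * k * m - l^2 = 4 * k * M" by (simp add: M_def l power2_eq_square algebra_simps)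
    ultimately show ?thesis unfolding kM using BB2 uv BB' by (auto simp: algebra_simps)
  qed
qed

lemma constant_inner_derivative:
  fixes f g :: "real \<Rightarrow> 'a::real_inner"
  assumes "(f has_vector_derivative f') (at t)" "(g has_vector_derivative g') (at t)"
    and "open U" "t \<in> U" "\<And>s. s \<in> U \<Longrightarrow> f s \<bullet> g s = k"
  shows "f' \<bullet> g t + f t \<bullet> g' = 0"
proof -
  have "((\<lambda>s. f s \<bullet> g s) has_vector_derivative (f t \<bullet> g' + f' \<bullet> g t)) (at t)"
    using bounded_bilinear.has_vector_derivative[OF bounded_bilinear_inner assms(1,2)] .
  moreover have "((\<lambda>s. f s \<bullet> g s) has_vector_derivative 0) (at t)"
    by (rule has_vector_derivative_transform_within_open[OF has_vector_derivative_const assms(3,4)])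
      (simp add: assms(5))
  ultimately show ?thesis using vector_derivative_unique_at by fastforce
qed

text \<open>
  Differentiating \<open>q f = P\<close> gives \<open>q f' + q' f = P'\<close> with \<open>f'\<close> and \<open>f\<close> perpendicular, hence
  \<open>q\<^sup>2 \<bar>f'\<bar>\<^sup>2 = \<bar>P'\<bar>\<^sup>2 - q'\<^sup>2\<close>. The hypotheses on the coefficients make the right-hand side constant.
\<close>

lemma quadratic_field_speed:
  fixes f :: "real \<Rightarrow> 'a::real_inner"
  assumes f: "(f has_vector_derivative f') (at t)"
    and U: "open U" "t \<in> U" and unit: "\<And>s. s \<in> U \<Longrightarrow> f s \<bullet> f s = 1"
    and eq: "\<And>s. s \<in> U \<Longrightarrow> (k * s^2 + l * s + m) *\<^sub>R f s = s^2 *\<^sub>R A + s *\<^sub>R B + C"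
    and coeffs: "A \<bullet> A = k^2" "A \<bullet> B = k * l"
  shows "(k * t^2 + l * t + m)^2 * (f' \<bullet> f') = B \<bullet> B - l^2"
proof -
  let ?q = "k * t^2 + l * t + m" and ?q' = "2 * k * t + l"
  have "((\<lambda>s. (k * s^2 + l * s + m) *\<^sub>R f s) has_vector_derivative ?q *\<^sub>R f' + ?q' *\<^sub>R f t) (at t)"
    by (rule has_vector_derivative_scaleR[OF _ f]) (auto intro!: derivative_eq_intros)
  moreover have "((\<lambda>s. (k * s^2 + l * s + m) *\<^sub>R f s) has_vector_derivative (2 * t) *\<^sub>R A + B) (at t)"
    by (rule has_vector_derivative_transform_within_open[OF _ U, where f = "\<lambda>s. s^2 *\<^sub>R A + s *\<^sub>R B + C"])
      (auto intro!: derivative_eq_intros simp: eq)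
  ultimately have "?q *\<^sub>R f' + ?q' *\<^sub>R f t = (2 * t) *\<^sub>R A + B"
    by (rule vector_derivative_unique_at)
  then have "(?q *\<^sub>R f' + ?q' *\<^sub>R f t) \<bullet> (?q *\<^sub>R f' + ?q' *\<^sub>R f t) = ((2 * t) *\<^sub>R A + B) \<bullet> ((2 * t) *\<^sub>R A + B)"
    by simp
  moreover have "f' \<bullet> f t = 0"
    using constant_inner_derivative[OF f f U, of 1] unit by (simp add: inner_commute)
  ultimately have "?q^2 * (f' \<bullet> f') + ?q'^2 = 4 * t^2 * (A \<bullet> A) + 4 * t * (A \<bullet> B) + B \<bullet> B"
    using unit[OF U(2)]
    by (simp add: inner_add_left inner_add_right inner_commute[of "f t" f'] inner_commute[of B A]
        power2_eq_square algebra_simps)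
  then show ?thesis unfolding coeffs by (simp add: power2_eq_square algebra_simps)
qed

lemma poly_degree_le_2:
  fixes p :: "real poly"
  assumes "degree p \<le> 2"
  shows "poly p t = coeff p 2 * t^2 + coeff p 1 * t + coeff p 0"
proof -
  have "p = [:coeff p 0, coeff p 1, coeff p 2:]"
    using assms by (intro poly_eqI) (auto simp: coeff_pCons coeff_eq_0 numeral_2_eq_2 split: nat.split)
  then have "poly p t = poly [:coeff p 0, coeff p 1, coeff p 2:] t" by simp
  then show ?thesis by (simp add: power2_eq_square algebra_simps)
qed

text \<open>
  Vector form of a field of degree 2. Degree exactly 2 is what makes one of the leading
  coefficients nonzero.
\<close>

lemma degree_2_field_coefficients:
  assumes "rational_field_of_degree I f 2"
  obtains A B C :: "real ^ 3" and k l m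
  where "\<And>t. t \<in> I \<Longrightarrow> k * t^2 + l * t + m \<noteq> 0"
    and "\<And>t. t \<in> I \<Longrightarrow> (k * t^2 + l * t + m) *\<^sub>R f t = t^2 *\<^sub>R A + t *\<^sub>R B + C"
    and "A \<noteq> 0 \<or> k \<noteq> 0"
proof -
  obtain p q where f: "\<forall>t\<in>I. poly q t \<noteq> 0 \<and> (\<forall>i. f t $ i = poly (p i) t / poly q t)"
    and Max: "Max (insert (degree q) (range (\<lambda>i. degree (p i)))) = 2"
    using assms unfolding rational_field_of_degree_def by blast
  let ?d = "insert (degree q) (range (\<lambda>i. degree (p i)))"
  have fin: "finite ?d" by simp
  have le: "degree q \<le> 2" "degree (p i) \<le> 2" for i
    using Max_ge[OF fin] Max by auto
  have "2 \<in> ?d" using Max_in[OF fin] Max by auto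
  then have top: "degree q = 2 \<or> (\<exists>i. degree (p i) = 2)" by auto
  define coef :: "nat \<Rightarrow> real ^ 3" where "coef n = (\<chi> i. coeff (p i) n)" for n
  show thesis
  proof (rule that[of "coeff q 2" "coeff q 1" "coeff q 0" "coef 2" "coef 1" "coef 0"])
    fix t assume t: "t \<in> I"
    show "coeff q 2 * t^2 + coeff q 1 * t + coeff q 0 \<noteq> 0"
      using f t unfolding poly_degree_le_2[OF le(1), symmetric] by blast
    show "(coeff q 2 * t^2 + coeff q 1 * t + coeff q 0) *\<^sub>R f t = t^2 *\<^sub>R coef 2 + t *\<^sub>R coef 1 + coef 0"
      using f t unfolding poly_degree_le_2[OF le(1), symmetric]
      by (simp add: vec_eq_iff coef_def poly_degree_le_2[OF le(2), of _ t] mult.commute)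
  next
    show "coef 2 \<noteq> 0 \<or> coeff q 2 \<noteq> 0"
    proof -
      have "coeff h 2 \<noteq> 0" if "degree h = 2" for h :: "real poly"
        using that leading_coeff_0_iff[of h] by auto
      then show ?thesis using top by (auto simp: coef_def vec_eq_iff)
    qed
  qed
qed

section \<open>The axis seen from a rotation minimizing frame\<close>

lemma orthonormal_basis_inner:
  assumes "orthonormal_basis u v w"
  shows "x \<bullet> y = (x \<bullet> u) * (y \<bullet> u) + (x \<bullet> v) * (y \<bullet> v) + (x \<bullet> w) * (y \<bullet> w)"
proof -
  have o: "u \<bullet> u = 1" "v \<bullet> v = 1" "w \<bullet> w = 1" "u \<bullet> v = 0" "u \<bullet> w = 0" "v \<bullet> w = 0"
    and sp: "span {u, v, w} = UNIV"
    using assms by (auto simp: orthonormal_basis_def orthogonal_def dot_square_norm)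
  define d where "d = x - (x \<bullet> u) *\<^sub>R u - (x \<bullet> v) *\<^sub>R v - (x \<bullet> w) *\<^sub>R w"
  have "orthogonal d e" if "e \<in> {u, v, w}" for e
    using that o by (auto simp: d_def orthogonal_def inner_diff_left inner_commute[of w v] inner_commute[of w u] inner_commute[of v u])
  then have "orthogonal d e" for e
    using orthogonal_to_span[of e "{u,v,w}" d] sp by simp
  then have "d \<bullet> y = 0" by (simp add: orthogonal_def)
  then show ?thesis by (simp add: d_def inner_diff_left inner_commute[of y])
qed

text \<open>
  The rotation minimizing condition says that \<open>f'\<close> and \<open>g'\<close> are parallel to \<open>T\<close>, which has the
  constant component \<open>c\<close> along \<open>a\<close>. For \<open>G = f \<bullet> a + \<i> (g \<bullet> a)\<close> this yields
  \<open>G' = - c w\<close>, where \<open>w = T' \<bullet> f + \<i> (T' \<bullet> g)\<close>. As \<open>T'\<close> is perpendicular to \<open>a\<close> and to \<open>T\<close>, the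
  plane vectors \<open>w\<close> and \<open>G\<close> are perpendicular, so that \<open>w / G\<close> is purely imaginary and
  \<open>w\<^sup>2 / G\<^sup>2 = - \<bar>w\<bar>\<^sup>2 / \<bar>G\<bar>\<^sup>2\<close> with \<open>\<bar>w\<bar> = \<bar>T'\<bar>\<close> and \<open>\<bar>G\<bar>\<^sup>2 = 1 - c\<^sup>2\<close>.
\<close>

lemma frame_axis_ode:
  assumes onb: "orthonormal_basis T f g"
    and rel: "T' \<bullet> T = 0" "f' \<bullet> f = 0" "g' \<bullet> g = 0" "f' \<bullet> T = - (T' \<bullet> f)" "g' \<bullet> T = - (T' \<bullet> g)"
       "f' \<bullet> g = 0" "g' \<bullet> f = 0"
    and a: "norm a = 1" "T \<bullet> a = c" "T' \<bullet> a = 0"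
  shows "of_real (1 - c^2) * Complex (f' \<bullet> a) (g' \<bullet> a) ^ 2
      = - of_real (c^2 * (T' \<bullet> T')) * Complex (f \<bullet> a) (g \<bullet> a) ^ 2"
proof -
  note e = orthonormal_basis_inner[OF onb]
  have f': "f' \<bullet> a = - c * (T' \<bullet> f)" and g': "g' \<bullet> a = - c * (T' \<bullet> g)"
    using e[of f' a] e[of g' a] rel a by (simp_all add: inner_commute[of a T])
  define x y p r where "x = f \<bullet> a" and "y = g \<bullet> a" and "p = T' \<bullet> f" and "r = T' \<bullet> g"
  have s: "1 - c^2 = x^2 + y^2"
    using e[of a a] a by (simp add: dot_square_norm x_def y_def inner_commute[of a] power2_eq_square)
  have n: "T' \<bullet> T' = p^2 + r^2"
    using e[of T' T'] rel by (simp add: p_def r_def power2_eq_square)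
  have "p * x + r * y = 0"
    using e[of T' a] rel a by (simp add: x_def y_def p_def r_def inner_commute[of a])
  moreover have "(x^2 + y^2) * (p^2 - r^2) = - (p^2 + r^2) * (x^2 - y^2) + 2 * (p * x - r * y) * (p * x + r * y)"
    "(x^2 + y^2) * (2 * p * r) = - (p^2 + r^2) * (2 * x * y) + 2 * (r * x + p * y) * (p * x + r * y)"
    by (simp_all add: power2_eq_square algebra_simps)
  ultimately have sq: "(x^2 + y^2) * (p^2 - r^2) = - (p^2 + r^2) * (x^2 - y^2)"
    "(x^2 + y^2) * (2 * p * r) = - (p^2 + r^2) * (2 * x * y)" by simp_all
  have sq_parts: "Complex v w ^ 2 = Complex (v^2 - w^2) (2 * v * w)" for v w
    by (simp add: complex_eq_iff power2_eq_square)
  have ode: "of_real (x^2 + y^2) * Complex p r ^ 2 = - of_real (p^2 + r^2) * Complex x y ^ 2"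
    unfolding sq_parts using sq by (simp add: complex_eq_iff)
  have "of_real (x^2 + y^2) * Complex (- c * p) (- c * r) ^ 2
      = of_real (c^2) * (of_real (x^2 + y^2) * Complex p r ^ 2)"
    unfolding sq_parts by (simp add: complex_eq_iff power2_eq_square algebra_simps)
  also have "\<dots> = - of_real (c^2 * (p^2 + r^2)) * Complex x y ^ 2"
    unfolding ode by (simp add: algebra_simps)
  finally show ?thesis
    unfolding f' g' x_def[symmetric] y_def[symmetric] p_def[symmetric] r_def[symmetric] s n .
qed

lemma smooth_on_derivative:
  assumes "smooth_on I f" "t \<in> interior I"
  shows "(f has_vector_derivative deriv_on I f t) (at t)"
proof -
  have tI: "t \<in> I" and at: "at t within I = at t"
    using assms(2) interior_subset at_within_interior by blast+
  obtain D where D: "\<forall>t\<in>I. D 0 t = f t"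
    "\<forall>n. \<forall>t\<in>I. (D n has_vector_derivative D (Suc n) t) (at t within I)"
    using assms(1) unfolding smooth_on_def by blast
  have "(f has_vector_derivative D 1 t) (at t within I)"
    by (rule has_vector_derivative_transform[OF tI _ , of f "D 0"]) (use D tI in auto)
  then show ?thesis
    unfolding deriv_on_def at by (metis vector_derivative_at)
qed

section \<open>Pairs of rational functions as complex quotients\<close>

lemma rational_on_add:
  assumes "rational_on I f" "rational_on I g"
  shows "rational_on I (\<lambda>t. f t + g t)"
proof -
  from assms obtain p q u v where "\<forall>t\<in>I. poly q t \<noteq> 0 \<and> f t = poly p t / poly q t"
    "\<forall>t\<in>I. poly v t \<noteq> 0 \<and> g t = poly u t / poly v t" unfolding rational_on_def by blast
  then have "\<forall>t\<in>I. poly (q * v) t \<noteq> 0 \<and> f t + g t = poly (p * v + u * q) t / poly (q * v) t"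
    by (simp add: add_frac_eq)
  then show ?thesis unfolding rational_on_def by blast
qed

lemma rational_on_cmult:
  assumes "rational_on I f"
  shows "rational_on I (\<lambda>t. f t * c)"
proof -
  from assms obtain p q where "\<forall>t\<in>I. poly q t \<noteq> 0 \<and> f t = poly p t / poly q t"
    unfolding rational_on_def by blast
  then have "\<forall>t\<in>I. poly q t \<noteq> 0 \<and> f t * c = poly (smult c p) t / poly q t"
    by simp
  then show ?thesis unfolding rational_on_def by blast
qed

lemma rational_on_inner:
  assumes "rational_field_on I f"
  shows "rational_on I (\<lambda>t. f t \<bullet> a)"
  using assms unfolding rational_field_on_def inner_vec_def sum_3 inner_real_def
  by (intro rational_on_add rational_on_cmult) auto

lemma poly_map_poly_of_real: "poly (map_poly of_real p) (of_real x) = (of_real (poly p x) :: complex)"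
  by (induction p) (auto simp: map_poly_pCons)

text \<open>
  Complex polynomials are needed because the argument takes place at a root of a real
  quadratic without real roots.
\<close>

lemma rational_pair_as_complex_quotient:
  assumes "rational_on I x" "rational_on I y"
  obtains A B :: "complex poly"
  where "\<And>t. t \<in> I \<Longrightarrow> poly B (of_real t) \<noteq> 0"
    and "\<And>t. t \<in> I \<Longrightarrow> Complex (x t) (y t) = poly A (of_real t) / poly B (of_real t)"
proof -
  from assms obtain p q u v where 1: "\<forall>t\<in>I. poly q t \<noteq> 0 \<and> x t = poly p t / poly q t"
    "\<forall>t\<in>I. poly v t \<noteq> 0 \<and> y t = poly u t / poly v t" unfolding rational_on_def by blast
  let ?c = "map_poly complex_of_real"
  show thesis
  proof (rule that[of "?c (q * v)" "?c (p * v) + smult \<i> (?c (u * q))"])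
    fix t assume t: "t \<in> I"
    show "poly (?c (q * v)) (of_real t) \<noteq> 0"
      using 1 t by (simp add: poly_map_poly_of_real)
    have nz: "poly q t \<noteq> 0" "poly v t \<noteq> 0" using 1 t by auto
    show "Complex (x t) (y t) = poly (?c (p * v) + smult \<i> (?c (u * q))) (of_real t) / poly (?c (q * v)) (of_real t)"
      using 1 t nz unfolding poly_add poly_smult poly_map_poly_of_real Complex_eq
      by (simp add: field_simps)
  qed
qed

lemma complex_quotient_derivative:
  fixes A B :: "complex poly" and f g :: "real \<Rightarrow> 'a::real_inner"
  assumes f: "(f has_vector_derivative f') (at t)" and g: "(g has_vector_derivative g') (at t)"
    and U: "open U" "t \<in> U" and B: "poly B (of_real t) \<noteq> 0"
    and eq: "\<And>s. s \<in> U \<Longrightarrow> Complex (f s \<bullet> a) (g s \<bullet> a) = poly A (of_real s) / poly B (of_real s)"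
  shows "Complex (f' \<bullet> a) (g' \<bullet> a) =
    (poly (pderiv A) (of_real t) * poly B (of_real t) - poly A (of_real t) * poly (pderiv B) (of_real t))
      / poly B (of_real t) ^ 2" (is "_ = ?d")
proof -
  have bl: "bounded_linear (\<lambda>v::'a. complex_of_real (v \<bullet> a))" "bounded_linear (\<lambda>v::'a. \<i> * complex_of_real (v \<bullet> a))"
    by (intro bounded_linear_intros bounded_linear_compose[OF bounded_linear_of_real]
        bounded_linear_compose[OF bounded_linear_mult_right])+
  have "((\<lambda>s. of_real (f s \<bullet> a) + \<i> * of_real (g s \<bullet> a)) has_vector_derivative
      of_real (f' \<bullet> a) + \<i> * of_real (g' \<bullet> a)) (at t)"
    by (intro has_vector_derivative_add bounded_linear.has_vector_derivative[OF bl(1)]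
        bounded_linear.has_vector_derivative[OF bl(2)] f g)
  then have "((\<lambda>s. Complex (f s \<bullet> a) (g s \<bullet> a)) has_vector_derivative Complex (f' \<bullet> a) (g' \<bullet> a)) (at t)"
    by (simp add: Complex_eq)
  moreover have "((\<lambda>s. poly A (of_real s) / poly B (of_real s)) has_vector_derivative ?d) (at t)"
    by (rule has_vector_derivative_real_field) (use B in \<open>auto intro!: derivative_eq_intros simp: power2_eq_square\<close>)
  then have "((\<lambda>s. Complex (f s \<bullet> a) (g s \<bullet> a)) has_vector_derivative ?d) (at t)"
    by (rule has_vector_derivative_transform_within_open[OF _ U]) (simp add: eq)
  ultimately show ?thesis by (rule vector_derivative_unique_at)
qed

section \<open>Nonexistence of a rational rotation minimizing frame\<close>

theorem theorem1:
  fixes I :: "real set" and r :: "real \<Rightarrow> real ^ 3"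
  assumes "parameter_interval I"
    and "rational_helix I r"
    and "rational_field_of_degree I (unit_tangent I r) 2"
    and "traces_small_circle I (unit_tangent I r)"
    and "\<forall>t\<in>I. deriv_on I (unit_tangent I r) t \<noteq> 0"
  shows "\<not> (\<exists>f1 f2 f3. rational_rotation_minimizing_frame I r f1 f2 f3)"
proof
  assume "\<exists>f1 f2 f3. rational_rotation_minimizing_frame I r f1 f2 f3"
  then obtain T f g where onb: "\<And>t. t \<in> I \<Longrightarrow> orthonormal_basis (T t) (f t) (g t)"
    and smooth: "smooth_on I T" "smooth_on I f" "smooth_on I g"
    and T: "\<And>t. t \<in> I \<Longrightarrow> T t = unit_tangent I r t"
    and rm: "\<And>t. t \<in> I \<Longrightarrow> deriv_on I f t \<bullet> g t = 0"
    and rat: "rational_field_on I f" "rational_field_on I g"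
    unfolding rational_rotation_minimizing_frame_def rotation_minimizing_frame_def adapted_frame_def
    by blast
  \<comment> \<open>Restriction to the interior replaces derivatives within \<open>I\<close> by ordinary ones; infinitely many
    parameters suffice for the polynomial identities.\<close>
  define U where "U = interior I"
  have U: "open U" and UI: "\<And>t. t \<in> U \<Longrightarrow> t \<in> I" and "U \<noteq> {}"
    using assms(1) interior_subset by (auto simp: U_def parameter_interval_def)
  have Uinf: "infinite U"
    using U \<open>U \<noteq> {}\<close> by (metis equals0I finite_imp_not_open)
  define T' f' g' where "T' = deriv_on I T" and "f' = deriv_on I f" and "g' = deriv_on I g"
  have der: "(T has_vector_derivative T' t) (at t)" "(f has_vector_derivative f' t) (at t)"
    "(g has_vector_derivative g' t) (at t)" if "t \<in> U" for t
    using that smooth smooth_on_derivative unfolding T'_def f'_def g'_def U_def by blast+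
  have T'_nz: "T' t \<noteq> 0" if "t \<in> U" for t
  proof -
    have "(unit_tangent I r has_vector_derivative T' t) (at t)"
      by (rule has_vector_derivative_transform_within_open[OF der(1)[OF that] U that]) (simp add: T UI)
    then have "deriv_on I (unit_tangent I r) t = T' t"
      using that at_within_interior[of t I] by (simp add: deriv_on_def U_def vector_derivative_at)
    then show ?thesis using assms(5) UI[OF that] by auto
  qed
  have frame: "T t \<bullet> T t = 1" "f t \<bullet> f t = 1" "g t \<bullet> g t = 1" "T t \<bullet> f t = 0" "T t \<bullet> g t = 0" "f t \<bullet> g t = 0"
    if "t \<in> U" for t
    using onb[OF UI[OF that]] by (auto simp: orthonormal_basis_def orthogonal_def dot_square_norm)

  obtain a c where a: "norm a = 1" and c: "\<bar>c\<bar> < 1" "c \<noteq> 0" and plane: "\<And>t. t \<in> U \<Longrightarrow> T t \<bullet> a = c"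
  proof -
    obtain C where C: "small_circle C" "unit_tangent I r ` I \<subseteq> C"
      using assms(4) unfolding traces_small_circle_def by blast
    then obtain a c where ac: "norm a = 1" "\<bar>c\<bar> < 1" "C = {x \<in> sphere 0 1. x \<bullet> a = c}"
      unfolding small_circle_def circle_on_sphere_def by blast
    moreover have "c \<noteq> 0"
      using C(1) ac unfolding small_circle_def great_circle_def by blast
    moreover have "T t \<bullet> a = c" if "t \<in> U" for t
      using C(2) UI[OF that] ac(3) T by auto
    ultimately show thesis using that by blast
  qed
  have c2: "0 < c^2" "c^2 < 1" using c by (auto simp: abs_square_less_1)

  obtain A B C k l m where nz: "\<And>t. t \<in> I \<Longrightarrow> k * t^2 + l * t + m \<noteq> 0"
    and T_eq0: "\<And>t. t \<in> I \<Longrightarrow> (k * t^2 + l * t + m) *\<^sub>R unit_tangent I r t = t^2 *\<^sub>R A + t *\<^sub>R B + C"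
    and nondeg: "A \<noteq> 0 \<or> k \<noteq> 0"
    using degree_2_field_coefficients[OF assms(3)] by metis
  have T_eq: "(k * t^2 + l * t + m) *\<^sub>R T t = t^2 *\<^sub>R A + t *\<^sub>R B + C" if "t \<in> U" for t
    using T_eq0 T UI[OF that] by simp
  have on_sphere: "(t^2 *\<^sub>R A + t *\<^sub>R B + C) \<bullet> (t^2 *\<^sub>R A + t *\<^sub>R B + C) = (k * t^2 + l * t + m)^2"
    and in_plane: "(t^2 *\<^sub>R A + t *\<^sub>R B + C) \<bullet> a = c * (k * t^2 + l * t + m)" if "t \<in> U" for t
    unfolding T_eq[OF that, symmetric] using frame(1)[OF that] plane[OF that]
    by (simp_all add: power2_eq_square)
  note coeffs = quadratic_circle_coefficients[OF a Uinf on_sphere in_plane nondeg]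
  define D where "D = 4 * k * m - l^2"
  have speed: "(k * t^2 + l * t + m)^2 * (T' t \<bullet> T' t) = B \<bullet> B - l^2" if "t \<in> U" for t
    by (rule quadratic_field_speed[OF der(1)[OF that] U that frame(1) T_eq coeffs(2,3)])
  obtain t0 where t0: "t0 \<in> U" using \<open>U \<noteq> {}\<close> by blast
  have "B \<bullet> B - l^2 \<noteq> 0"
    using speed[OF t0] T'_nz[OF t0] nz[OF UI[OF t0]] by (metis inner_eq_zero_iff mult_eq_0_iff power_eq_0_iff)
  then have BD: "B \<bullet> B - l^2 = (1 - c^2) * D" and D: "D \<noteq> 0"
    using coeffs(4) by (auto simp: D_def)

  obtain P Q :: "complex poly" where Q: "\<And>t. t \<in> I \<Longrightarrow> poly Q (of_real t) \<noteq> 0"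
    and G: "\<And>t. t \<in> I \<Longrightarrow> Complex (f t \<bullet> a) (g t \<bullet> a) = poly P (of_real t) / poly Q (of_real t)"
    using rational_pair_as_complex_quotient[OF rational_on_inner[OF rat(1), of a] rational_on_inner[OF rat(2), of a]] by metis
  \<comment> \<open>If \<open>a\<close> had no component along \<open>f\<close> and \<open>g\<close>, then \<open>T\<close> would be \<open>a\<close> or \<open>- a\<close>, against \<open>\<bar>c\<bar> < 1\<close>.\<close>
  have "P \<noteq> 0"
  proof
    assume "P = 0"
    then have "f t0 \<bullet> a = 0 \<and> g t0 \<bullet> a = 0"
      using G[OF UI[OF t0]] by (simp add: complex_eq_iff)
    then have "a \<bullet> a = c^2"
      using orthonormal_basis_inner[OF onb[OF UI[OF t0]], of a a] plane[OF t0]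
      by (simp add: inner_commute[of a "T t0"] inner_commute[of a "f t0"] inner_commute[of a "g t0"] power2_eq_square)
    then show False using a c2 by (simp add: dot_square_norm)
  qed
  have "\<exists>n::int. c^2 = (of_int n)^2"
  proof (rule log_derivative_exponent_integral[OF Uinf coeffs(1) _ \<open>P \<noteq> 0\<close>])
    show "4 * k * m - l^2 \<noteq> 0" using D by (simp add: D_def)
    fix t assume t: "t \<in> U"
    show "poly Q (of_real t) \<noteq> 0" using Q UI[OF t] .
    let ?q = "k * t^2 + l * t + m"
    let ?G = "Complex (f t \<bullet> a) (g t \<bullet> a)" and ?G' = "Complex (f' t \<bullet> a) (g' t \<bullet> a)"
    note d = constant_inner_derivative[OF _ _ U t]
    have "T' t \<bullet> T t = 0" "f' t \<bullet> f t = 0" "g' t \<bullet> g t = 0"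
      using d[OF der(1)[OF t] der(1)[OF t] frame(1)] d[OF der(2)[OF t] der(2)[OF t] frame(2)]
        d[OF der(3)[OF t] der(3)[OF t] frame(3)] by (simp_all add: inner_commute)
    moreover have "f' t \<bullet> T t = - (T' t \<bullet> f t)" "g' t \<bullet> T t = - (T' t \<bullet> g t)"
      using d[OF der(1)[OF t] der(2)[OF t] frame(4)] d[OF der(1)[OF t] der(3)[OF t] frame(5)]
      by (simp_all add: inner_commute)
    moreover have rmf: "f' t \<bullet> g t = 0" using rm UI[OF t] by (simp add: f'_def)
    moreover have "g' t \<bullet> f t = 0"
      using d[OF der(2)[OF t] der(3)[OF t] frame(6)] rmf by (simp add: inner_commute)
    moreover have "T' t \<bullet> a = 0"
      using d[OF der(1)[OF t] has_vector_derivative_const plane] by simp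
    ultimately have ode: "of_real (1 - c^2) * ?G'^2 = - of_real (c^2 * (T' t \<bullet> T' t)) * ?G^2"
      using frame_axis_ode[OF onb[OF UI[OF t]] _ _ _ _ _ _ _ a plane[OF t]] by blast
    have "of_real (1 - c^2) * (of_real (?q^2) * ?G'^2) = of_real (?q^2) * (of_real (1 - c^2) * ?G'^2)"
      by (simp only: mult_ac)
    also have "\<dots> = - of_real (c^2 * (?q^2 * (T' t \<bullet> T' t))) * ?G^2"
      unfolding ode by (simp only: of_real_mult mult_ac mult_minus_left mult_minus_right)
    also have "\<dots> = of_real (1 - c^2) * (- of_real (c^2 * D) * ?G^2)"
      unfolding speed[OF t] BD by (simp only: of_real_mult mult_ac mult_minus_left mult_minus_right)
    finally have "of_real (?q^2) * ?G'^2 = - of_real (c^2 * D) * ?G^2"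
      using c2(2) by (simp only: mult_cancel_left of_real_eq_0_iff) auto
    moreover have "?G' = (poly (pderiv P) (of_real t) * poly Q (of_real t) - poly P (of_real t) * poly (pderiv Q) (of_real t))
          / poly Q (of_real t) ^ 2"
      by (rule complex_quotient_derivative[OF der(2)[OF t] der(3)[OF t] U t Q[OF UI[OF t]] G[OF UI]])
    ultimately show "of_real (?q^2) *
        ((poly (pderiv P) (of_real t) * poly Q (of_real t) - poly P (of_real t) * poly (pderiv Q) (of_real t))
          / poly Q (of_real t) ^ 2) ^ 2
      = - of_real (c^2 * (4 * k * m - l^2)) * (poly P (of_real t) / poly Q (of_real t)) ^ 2"
      unfolding D_def using G[OF UI[OF t]] by simp
  qed
  then obtain n :: int where "c^2 = of_int (n^2)" by auto
  then have "0 < n^2" "n^2 < 1" using c2 by linarith+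
  then show False by linarith
qed

end
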